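(* Let $k,d\ge 0$ be integers. If $M$ is a torsion-free FI-module generated in degree $\le k$, and $V\subset M$ is a sub-FI-module generated in degree $\le d$, then the quotient $M/V$ is torsion-free in degrees $\ge\min(k,d)+d$.
   Context: $\mathrm{FI}$ is the category of finite sets and injections. An FI-module is a functor $W\colon \mathrm{FI}\to \mathbb{Z}\text{-Mod}$; write $W_T=W(T)$, $[n]=\{1,\dots,n\}$, $W_n=W_{[n]}$, and $f_*\colon W_S\to W_T$ for the map induced by an injection $f$. Degree: $\deg W=\inf\{k\in\{-\infty\}\cup\mathbb{N}\cup\{\infty\}\mid W_n=0\text{ for all }n\in\mathbb{N}\text{ with }n>k\}$. Define $H_0(W)_T=W_T/\operatorname{span}(\operatorname{im} f_*\colon W_S\to W_T\mid f\colon S\hookrightarrow T,\ |S|<|T|)$. $W$ is generated in degree $\le m$ if $\deg H_0(W)\le m$. An FI-module $W$ is torsion-free if $f_*\colon W_S\to W_T$ is injective for every injection $f\colon S\hookrightarrow T$ of finite sets. It is torsion-free in degrees $\ge m$ if $f_*\colon W_S\to W_T$ is injective for every injection $f\colon S\hookrightarrow T$ of finite sets with $|S|\ge m$. *)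

theory Defs
  imports "HOL-Algebra.Algebra" "HOL-Library.Extended_Real"
begin

text \<open>
  The category FI is represented by its full subcategory on the finite sets of natural
  numbers, to which it is equivalent. Morphisms are injections, made extensional
  outside their domain. The category of \<open>\<int>\<close>-modules is the category of
  abelian groups, written multiplicatively as in HOL-Algebra, so the zero module is a
  group with carrier \<open>{\<one>}\<close>.
\<close>

definition FI_hom :: "nat set \<Rightarrow> nat set \<Rightarrow> (nat \<Rightarrow> nat) set"
  where "FI_hom S T = {f \<in> S \<rightarrow>\<^sub>E T. inj_on f S}"

text \<open>\<open>ind W S T f\<close> is the map \<open>f\<^sub>*\<close> induced by an injection \<open>f\<close> from \<open>S\<close> to \<open>T\<close>.\<close>

record 'a FI_functor =
  ob :: "nat set \<Rightarrow> 'a monoid"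
  ind :: "nat set \<Rightarrow> nat set \<Rightarrow> (nat \<Rightarrow> nat) \<Rightarrow> 'a \<Rightarrow> 'a"

locale FI_module =
  fixes W :: "'a FI_functor"
  assumes ob_comm_group: "finite T \<Longrightarrow> comm_group (ob W T)"
    and ind_hom: "\<lbrakk>finite S; finite T; f \<in> FI_hom S T\<rbrakk> \<Longrightarrow> ind W S T f \<in> hom (ob W S) (ob W T)"
    and ind_id: "\<lbrakk>finite S; x \<in> carrier (ob W S)\<rbrakk> \<Longrightarrow> ind W S S (\<lambda>i\<in>S. i) x = x"
    and ind_compose: "\<lbrakk>finite S; finite T; finite U; f \<in> FI_hom S T; g \<in> FI_hom T U;
        x \<in> carrier (ob W S)\<rbrakk> \<Longrightarrow> ind W S U (compose S g f) x = ind W T U g (ind W S T f x)"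

locale sub_FI_module = FI_module W for W :: "'a FI_functor" +
  fixes V :: "nat set \<Rightarrow> 'a set"
  assumes sub_subgroup: "finite T \<Longrightarrow> subgroup (V T) (ob W T)"
    and sub_ind: "\<lbrakk>finite S; finite T; f \<in> FI_hom S T; x \<in> V S\<rbrakk> \<Longrightarrow> ind W S T f x \<in> V T"

definition FI_sub :: "'a FI_functor \<Rightarrow> (nat set \<Rightarrow> 'a set) \<Rightarrow> 'a FI_functor"
  where "FI_sub W V = \<lparr>ob = (\<lambda>T. (ob W T)\<lparr>carrier := V T\<rparr>), ind = ind W\<rparr>"

text \<open>The induced map on the quotient sends the coset of \<open>x\<close> to the coset of \<open>f\<^sub>* x\<close>;
  see \<open>FI_quot_ind\<close> below.\<close>

definition FI_quot :: "'a FI_functor \<Rightarrow> (nat set \<Rightarrow> 'a set) \<Rightarrow> 'a set FI_functor"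
  where "FI_quot W V = \<lparr>ob = (\<lambda>T. ob W T Mod V T),
     ind = (\<lambda>S T f C. the_elem ((\<lambda>x. V T #>\<^bsub>ob W T\<^esub> ind W S T f x) ` C))\<rparr>"

definition FI_degree :: "'a FI_functor \<Rightarrow> ereal"
  where "FI_degree W = Inf {k. (k = - \<infinity> \<or> k \<in> range (\<lambda>m::nat. ereal (real m)) \<or> k = \<infinity>) \<and>
     (\<forall>n::nat. ereal (real n) > k \<longrightarrow> carrier (ob W {1..n}) = {\<one>\<^bsub>ob W {1..n}\<^esub>})}"

definition span_from_smaller :: "'a FI_functor \<Rightarrow> nat set \<Rightarrow> 'a set"
  where "span_from_smaller W T = generate (ob W T)
     (\<Union>{ind W S T f ` carrier (ob W S) |S f. finite S \<and> card S < card T \<and> f \<in> FI_hom S T})"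

definition FI_H0 :: "'a FI_functor \<Rightarrow> 'a set FI_functor"
  where "FI_H0 W = FI_quot W (span_from_smaller W)"

definition generated_in_degree_le :: "'a FI_functor \<Rightarrow> nat \<Rightarrow> bool"
  where "generated_in_degree_le W m \<longleftrightarrow> FI_degree (FI_H0 W) \<le> ereal (real m)"

definition torsion_free :: "'a FI_functor \<Rightarrow> bool"
  where "torsion_free W \<longleftrightarrow> (\<forall>S T f. finite S \<and> finite T \<and> f \<in> FI_hom S T \<longrightarrow>
     inj_on (ind W S T f) (carrier (ob W S)))"

definition torsion_free_in_degrees_ge :: "'a FI_functor \<Rightarrow> nat \<Rightarrow> bool"
  where "torsion_free_in_degrees_ge W m \<longleftrightarrow>
     (\<forall>S T f. finite S \<and> finite T \<and> m \<le> card S \<and> f \<in> FI_hom S T \<longrightarrow>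
       inj_on (ind W S T f) (carrier (ob W S)))"

lemma FI_hom_compose: "\<lbrakk>f \<in> FI_hom S T; g \<in> FI_hom T U\<rbrakk> \<Longrightarrow> compose S g f \<in> FI_hom S U"
  by (auto simp: FI_hom_def compose_def inj_on_def PiE_iff extensional_def)

lemma FI_hom_id: "(\<lambda>i\<in>S. i) \<in> FI_hom S S"
  by (auto simp: FI_hom_def inj_on_def)

context sub_FI_module
begin

lemma sub_normal: "finite T \<Longrightarrow> V T \<lhd> ob W T"
  by (intro comm_group.subgroup_imp_normal ob_comm_group sub_subgroup)

lemma FI_module_FI_sub: "FI_module (FI_sub W V)"
proof (rule FI_module.intro)
  fix T :: "nat set" assume T: "finite T"
  show "comm_group (ob (FI_sub W V) T)"
  proof -
    interpret comm_group "ob W T" using ob_comm_group[OF T] .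
    interpret V: subgroup "V T" "ob W T" using sub_subgroup[OF T] .
    interpret V: group "(ob W T)\<lparr>carrier := V T\<rparr>" by (rule V.subgroup_is_group[OF is_group])
    have "comm_group ((ob W T)\<lparr>carrier := V T\<rparr>)"
      by (rule V.group_comm_groupI) (simp add: m_comm)
    then show ?thesis by (simp add: FI_sub_def)
  qed
next
  fix S T f assume A: "finite S" "finite T" "f \<in> FI_hom S T"
  show "ind (FI_sub W V) S T f \<in> hom (ob (FI_sub W V) S) (ob (FI_sub W V) T)"
    using ind_hom[OF A] sub_ind[OF A] subgroup.subset[OF sub_subgroup[OF A(1)]]
    by (auto simp: FI_sub_def hom_def Pi_iff subset_iff)
next
  fix S x assume "finite S" "x \<in> carrier (ob (FI_sub W V) S)"
  then show "ind (FI_sub W V) S S (\<lambda>i\<in>S. i) x = x"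
    using ind_id subgroup.mem_carrier[OF sub_subgroup] by (simp add: FI_sub_def)
next
  fix S T U f g x assume "finite S" "finite T" "finite U" "f \<in> FI_hom S T" "g \<in> FI_hom T U"
    "x \<in> carrier (ob (FI_sub W V) S)"
  then show "ind (FI_sub W V) S U (compose S g f) x = ind (FI_sub W V) T U g (ind (FI_sub W V) S T f x)"
    using ind_compose subgroup.mem_carrier[OF sub_subgroup] by (simp add: FI_sub_def)
qed

lemma FI_quot_ind:
  assumes "finite S" "finite T" "f \<in> FI_hom S T" "x \<in> carrier (ob W S)"
  shows "ind (FI_quot W V) S T f (V S #>\<^bsub>ob W S\<^esub> x) = V T #>\<^bsub>ob W T\<^esub> ind W S T f x"
proof -
  interpret S: comm_group "ob W S" using assms ob_comm_group by blast
  interpret T: comm_group "ob W T" using assms ob_comm_group by blast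
  interpret VS: subgroup "V S" "ob W S" using assms sub_subgroup by blast
  interpret VT: subgroup "V T" "ob W T" using assms sub_subgroup by blast
  note h = ind_hom[OF assms(1-3)]
  have fx: "ind W S T f x \<in> carrier (ob W T)" using h assms(4) by (auto simp: hom_def)
  have "V T #>\<^bsub>ob W T\<^esub> ind W S T f y = V T #>\<^bsub>ob W T\<^esub> ind W S T f x"
    if y: "y \<in> V S #>\<^bsub>ob W S\<^esub> x" for y
  proof -
    obtain v where v: "v \<in> V S" "y = v \<otimes>\<^bsub>ob W S\<^esub> x" using y by (auto simp: r_coset_def)
    have "ind W S T f y = ind W S T f v \<otimes>\<^bsub>ob W T\<^esub> ind W S T f x"
      using v assms(4) h by (simp add: hom_def)
    then have "ind W S T f y \<in> V T #>\<^bsub>ob W T\<^esub> ind W S T f x"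
      using sub_ind[OF assms(1-3) v(1)] by (auto simp: r_coset_def)
    then show ?thesis using T.repr_independence fx VT.subgroup_axioms by metis
  qed
  moreover have "x \<in> V S #>\<^bsub>ob W S\<^esub> x" using S.rcos_self assms VS.subgroup_axioms by blast
  ultimately have "(\<lambda>y. V T #>\<^bsub>ob W T\<^esub> ind W S T f y) ` (V S #>\<^bsub>ob W S\<^esub> x)
      = {V T #>\<^bsub>ob W T\<^esub> ind W S T f x}" by blast
  then show ?thesis by (simp add: FI_quot_def)
qed

lemma carrier_FI_quot: "carrier (ob (FI_quot W V) T) = (\<lambda>x. V T #>\<^bsub>ob W T\<^esub> x) ` carrier (ob W T)"
  by (auto simp: FI_quot_def FactGroup_def RCOSETS_def)

lemma mult_FI_quot:
  assumes "finite T" "x \<in> carrier (ob W T)" "y \<in> carrier (ob W T)"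
  shows "(V T #>\<^bsub>ob W T\<^esub> x) \<otimes>\<^bsub>ob (FI_quot W V) T\<^esub> (V T #>\<^bsub>ob W T\<^esub> y)
    = V T #>\<^bsub>ob W T\<^esub> (x \<otimes>\<^bsub>ob W T\<^esub> y)"
  using normal.rcos_sum[OF sub_normal] assms by (simp add: FI_quot_def FactGroup_def)

lemma FI_module_FI_quot: "FI_module (FI_quot W V)"
proof (rule FI_module.intro)
  fix T :: "nat set" assume T: "finite T"
  show "comm_group (ob (FI_quot W V) T)"
    using comm_group.abelian_FactGroup[OF ob_comm_group sub_subgroup] T
    by (simp add: FI_quot_def)
next
  fix S T f assume A: "finite S" "finite T" "f \<in> FI_hom S T"
  note h = ind_hom[OF A]
  have c: "x \<otimes>\<^bsub>ob W S\<^esub> y \<in> carrier (ob W S)" if "x \<in> carrier (ob W S)" "y \<in> carrier (ob W S)" for x y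
    using that ob_comm_group[OF A(1)] by (simp add: comm_group_def comm_monoid_def monoid.m_closed)
  show "ind (FI_quot W V) S T f \<in> hom (ob (FI_quot W V) S) (ob (FI_quot W V) T)"
    using h c by (auto simp: hom_def carrier_FI_quot FI_quot_ind[OF A] mult_FI_quot A Pi_iff)
next
  fix S x assume "finite S" "x \<in> carrier (ob (FI_quot W V) S)"
  then show "ind (FI_quot W V) S S (\<lambda>i\<in>S. i) x = x"
    by (auto simp: carrier_FI_quot FI_quot_ind FI_hom_id ind_id)
next
  fix S T U f g x assume A: "finite S" "finite T" "finite U" "f \<in> FI_hom S T" "g \<in> FI_hom T U"
    "x \<in> carrier (ob (FI_quot W V) S)"
  have "ind W S T f y \<in> carrier (ob W T)" if "y \<in> carrier (ob W S)" for y
    using ind_hom[OF A(1,2,4)] that by (auto simp: hom_def)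
  then show "ind (FI_quot W V) S U (compose S g f) x
      = ind (FI_quot W V) T U g (ind (FI_quot W V) S T f x)"
    using A by (auto simp: carrier_FI_quot FI_quot_ind FI_hom_compose ind_compose)
qed

end

lemma (in FI_module) sub_FI_module_span_from_smaller: "sub_FI_module W (span_from_smaller W)"
proof (intro sub_FI_module.intro sub_FI_module_axioms.intro FI_module_axioms)
  fix T :: "nat set" assume T: "finite T"
  interpret comm_group "ob W T" using ob_comm_group[OF T] .
  show "subgroup (span_from_smaller W T) (ob W T)"
    unfolding span_from_smaller_def using ind_hom[OF _ T]
    by (intro generate_is_subgroup) (auto simp: hom_def Pi_iff)
next
  fix S T f x assume A: "finite S" "finite T" "f \<in> FI_hom S T" and x: "x \<in> span_from_smaller W S"
  interpret S: comm_group "ob W S" using ob_comm_group[OF A(1)] .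
  interpret T: comm_group "ob W T" using ob_comm_group[OF A(2)] .
  interpret f: group_hom "ob W S" "ob W T" "ind W S T f"
    by unfold_locales (rule ind_hom[OF A])
  let ?G = "\<lambda>T. \<Union>{ind W S T f ` carrier (ob W S) |S f. finite S \<and> card S < card T \<and> f \<in> FI_hom S T}"
  have le: "card S \<le> card T" using A by (auto simp: FI_hom_def intro: card_inj_on_le)
  have sub: "?G S \<subseteq> carrier (ob W S)" using ind_hom[OF _ A(1)] by (auto simp: hom_def Pi_iff)
  have "ind W S T f ` ?G S \<subseteq> ?G T"
  proof
    fix z assume "z \<in> ind W S T f ` ?G S"
    then obtain R g y where R: "finite R" "card R < card S" "g \<in> FI_hom R S" "y \<in> carrier (ob W R)"
      and z: "z = ind W S T f (ind W R S g y)" by blast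
    have "z = ind W R T (compose R f g) y" using ind_compose R A z by simp
    moreover have "card R < card T" using R le by simp
    ultimately show "z \<in> ?G T" using R(1,4) FI_hom_compose[OF R(3) A(3)] by blast
  qed
  then have "generate (ob W T) (ind W S T f ` ?G S) \<subseteq> generate (ob W T) (?G T)"
    by (rule T.mono_generate)
  then show "ind W S T f x \<in> span_from_smaller W T"
    using f.generate_img[OF sub] x by (auto simp: span_from_smaller_def)
qed

end

theory Submission
  imports Defs
begin

text \<open>
  As \<open>M\<close> is torsion-free, everything happens inside \<open>M\<^sub>\<Omega>\<close> for a large finite set
  \<open>\<Omega>\<close>, in which \<open>M\<^sub>A\<close> and \<open>V\<^sub>A\<close> are subgroups for \<open>A \<subseteq> \<Omega>\<close>, permuted by the
  symmetric group. A transposition \<open>(i t)\<close> fixes \<open>M\<^sub>A\<close> if \<open>i, t \<notin> A\<close>, so a product of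
  \<open>k + 1\<close> disjoint factors \<open>1 - (i t)\<close> annihilates \<open>M\<close>.

  It suffices that \<open>x \<in> V\<^sub>T \<inter> M\<^bsub>T - c\<^esub>\<close> lies in \<open>V\<^bsub>T - c\<^esub>\<close> when
  \<open>card T > min k d + d\<close>. Such an \<open>x\<close> is annihilated by \<open>1 - (c t)\<close> for new \<open>t\<close>. Go through
  the other points \<open>b\<close> of \<open>T\<close>, recursively: if \<open>x\<close> is annihilated by
  \<open>\<Prod>\<^sub>i (1 - (i t\<^sub>i))\<close>, it is also annihilated after the factor \<open>1 - (b t\<^sub>b)\<close> is added, and the
  stronger conclusion for the longer product allows to remove \<open>b\<close> from the support of \<open>x\<close>.
  Once \<open>b\<close> is removed, it can serve as \<open>t\<^sub>i\<close> for an earlier \<open>i\<close>, and expanding the product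
  then expresses \<open>x\<close> by elements whose support lacks some \<open>i\<close>. The recursion ends when all
  chosen \<open>i\<close> are matched to such a \<open>b\<close>, when more than \<open>k\<close> of them are, or when more
  than \<open>d\<close> points are chosen, so that every generator of \<open>V\<close> misses one of them; the bound on
  \<open>card T\<close> makes one of these happen before the points of \<open>T\<close> are used up.
\<close>

section \<open>Homomorphisms on generated subgroups and extension of injections\<close>

lemma (in group_hom) generate_le_kernel:
  assumes "\<And>x. x \<in> S \<Longrightarrow> x \<in> carrier G \<and> h x = \<one>\<^bsub>H\<^esub>" and "x \<in> generate G S"
  shows "h x = \<one>\<^bsub>H\<^esub>"
proof -
  have "generate G S \<subseteq> kernel G H h"
    using assms(1) by (intro G.generate_subgroup_incl subgroup_kernel) (auto simp: kernel_def)
  then show ?thesis using assms(2) by (auto simp: kernel_def)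
qed

lemma inj_on_extend_permutation:
  assumes "finite \<Omega>" "A \<subseteq> \<Omega>" "inj_on f A" "f ` A \<subseteq> \<Omega>"
  obtains \<sigma> where "\<sigma> permutes \<Omega>" "\<And>a. a \<in> A \<Longrightarrow> \<sigma> a = f a"
proof -
  have fin: "finite A" "finite (f ` A)"
    using assms finite_subset by auto
  have "card (\<Omega> - A) = card (\<Omega> - f ` A)"
    using assms fin by (simp add: card_Diff_subset card_image)
  then obtain g where g: "bij_betw g (\<Omega> - A) (\<Omega> - f ` A)"
    using finite_same_card_bij[of "\<Omega> - A" "\<Omega> - f ` A"] assms(1) by auto
  let ?s = "\<lambda>x. if x \<in> A then f x else if x \<in> \<Omega> then g x else x"
  have "bij_betw ?s (A \<union> (\<Omega> - A)) (f ` A \<union> (\<Omega> - f ` A))"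
  proof (rule bij_betw_combine)
    show "bij_betw ?s A (f ` A)"
      using assms(3) by (auto simp: bij_betw_def inj_on_def)
    show "bij_betw ?s (\<Omega> - A) (\<Omega> - f ` A)"
      using g by (rule iffD1[OF bij_betw_cong, rotated]) auto
  qed auto
  then have "bij_betw ?s \<Omega> \<Omega>"
    using assms by (simp add: Un_absorb1)
  then have "?s permutes \<Omega>"
    using assms(2) by (intro bij_imp_permutes) auto
  then show thesis
    by (rule that) simp
qed

subsection \<open>Alternators on symmetric filtrations\<close>

text \<open>\<open>M B\<close> and \<open>V B\<close> model the images of the values at
  \<open>B\<close> in the value at \<Omega>. Generation of \<open>V\<close> is asked inside each
  \<open>B\<close>, so that generators stay within the current support; for \<open>M\<close> it
  concerns the whole group and serves to kill long products.\<close>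

locale symmetric_filtration = comm_group G for G (structure) +
  fixes \<Omega> :: "'i set" and act :: "('i \<Rightarrow> 'i) \<Rightarrow> 'a \<Rightarrow> 'a" and M V :: "'i set \<Rightarrow> 'a set"
    and k d :: nat
  assumes finite_Omega: "finite \<Omega>"
    and act_hom: "\<sigma> permutes \<Omega> \<Longrightarrow> act \<sigma> \<in> hom G G"
    and act_comp: "\<lbrakk>\<sigma> permutes \<Omega>; \<tau> permutes \<Omega>; x \<in> carrier G\<rbrakk> \<Longrightarrow> act (\<sigma> \<circ> \<tau>) x = act \<sigma> (act \<tau> x)"
    and act_fix: "\<lbrakk>\<sigma> permutes \<Omega>; B \<subseteq> \<Omega>; \<And>b. b \<in> B \<Longrightarrow> \<sigma> b = b; x \<in> M B\<rbrakk> \<Longrightarrow> act \<sigma> x = x"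
    and act_V: "\<lbrakk>\<sigma> permutes \<Omega>; B \<subseteq> \<Omega>; x \<in> V B\<rbrakk> \<Longrightarrow> act \<sigma> x \<in> V (\<sigma> ` B)"
    and V_subgroup: "B \<subseteq> \<Omega> \<Longrightarrow> subgroup (V B) G"
    and V_mono: "\<lbrakk>B \<subseteq> C; C \<subseteq> \<Omega>\<rbrakk> \<Longrightarrow> V B \<subseteq> V C"
    and M_mono: "\<lbrakk>B \<subseteq> C; C \<subseteq> \<Omega>\<rbrakk> \<Longrightarrow> M B \<subseteq> M C"
    and V_le_M: "B \<subseteq> \<Omega> \<Longrightarrow> V B \<subseteq> M B"
    and M_carrier: "B \<subseteq> \<Omega> \<Longrightarrow> M B \<subseteq> carrier G"
    and M_generated: "carrier G \<subseteq> generate G (\<Union>{M U |U. U \<subseteq> \<Omega> \<and> card U \<le> k})"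
    and V_generated: "B \<subseteq> \<Omega> \<Longrightarrow> V B \<subseteq> generate G (\<Union>{V U |U. U \<subseteq> B \<and> card U \<le> d})"
begin

lemma V_carrier: "\<lbrakk>B \<subseteq> \<Omega>; x \<in> V B\<rbrakk> \<Longrightarrow> x \<in> carrier G"
  using V_le_M M_carrier by blast

lemma act_closed: "\<lbrakk>\<sigma> permutes \<Omega>; x \<in> carrier G\<rbrakk> \<Longrightarrow> act \<sigma> x \<in> carrier G"
  by (rule hom_in_carrier[OF act_hom])

lemma act_group_hom: "\<sigma> permutes \<Omega> \<Longrightarrow> group_hom G G (act \<sigma>)"
  by unfold_locales (rule act_hom)

definition alt :: "'i \<Rightarrow> 'i \<Rightarrow> 'a \<Rightarrow> 'a"
  where "alt i t x = x \<otimes> inv act (transpose i t) x"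

text \<open>In additive notation, the product of the group ring elements
  \<open>1 - (i t\<^sub>i)\<close> over the entries \<open>i\<close> of the list.\<close>

fun alts :: "'i list \<Rightarrow> ('i \<Rightarrow> 'i) \<Rightarrow> 'a \<Rightarrow> 'a"
  where "alts [] t x = x"
  | "alts (i # L) t x = alt i (t i) (alts L t x)"

lemma alt_hom:
  assumes "i \<in> \<Omega>" "t \<in> \<Omega>"
  shows "group_hom G G (alt i t)"
proof -
  interpret a: group_hom G G "act (transpose i t)"
    by (rule act_group_hom[OF permutes_swap_id[OF assms]])
  show ?thesis
    using assms by unfold_locales (auto simp: hom_def alt_def inv_mult m_ac)
qed

lemma alts_hom: "\<lbrakk>set L \<subseteq> \<Omega>; t ` set L \<subseteq> \<Omega>\<rbrakk> \<Longrightarrow> group_hom G G (alts L t)"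
proof (induction L)
  case Nil
  show ?case by unfold_locales (simp add: hom_def)
next
  case (Cons i L)
  interpret a: group_hom G G "alts L t" using Cons by auto
  interpret b: group_hom G G "alt i (t i)" using Cons by (intro alt_hom) auto
  show ?case by unfold_locales (simp add: hom_def)
qed

text \<open>Conjugating \<open>(i t)\<close> by \<sigma> gives the transposition of
  \<open>\<sigma> i\<close> and \<open>\<sigma> t\<close>.\<close>

lemma act_alt:
  assumes "\<sigma> permutes \<Omega>" "i \<in> \<Omega>" "t \<in> \<Omega>" "x \<in> carrier G"
  shows "act \<sigma> (alt i t x) = alt (\<sigma> i) (\<sigma> t) (act \<sigma> x)"
proof -
  interpret s: group_hom G G "act \<sigma>" by (rule act_group_hom[OF assms(1)])
  have st: "\<sigma> i \<in> \<Omega>" "\<sigma> t \<in> \<Omega>" using assms permutes_in_image by metis+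
  have "\<sigma> \<circ> transpose i t = transpose (\<sigma> i) (\<sigma> t) \<circ> \<sigma>"
    using permutes_inj[OF assms(1)] by (auto simp: fun_eq_iff transpose_def inj_eq)
  then have "act \<sigma> (act (transpose i t) x) = act (transpose (\<sigma> i) (\<sigma> t)) (act \<sigma> x)"
    using act_comp[OF assms(1) permutes_swap_id[OF assms(2,3)] assms(4)]
      act_comp[OF permutes_swap_id[OF st] assms(1,4)] by simp
  then show ?thesis
    using assms by (simp add: alt_def act_closed permutes_swap_id)
qed

text \<open>Allows trading the partners in a product for others while keeping the points of
  \<open>L\<close>.\<close>

lemma act_alts:
  assumes "\<sigma> permutes \<Omega>" "x \<in> carrier G"
  shows "\<lbrakk>set L \<subseteq> \<Omega>; t ` set L \<subseteq> \<Omega>; \<And>i. i \<in> set L \<Longrightarrow> \<sigma> i = i \<and> \<sigma> (t i) = s i\<rbrakk>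
    \<Longrightarrow> act \<sigma> (alts L t x) = alts L s (act \<sigma> x)"
proof (induction L)
  case (Cons i L)
  interpret a: group_hom G G "alts L t" using Cons by (intro alts_hom) auto
  show ?case using Cons assms by (simp add: act_alt)
qed simp

lemma alt_eq_one:
  assumes "i \<in> \<Omega>" "t \<in> \<Omega>" "B \<subseteq> \<Omega>" "i \<notin> B" "t \<notin> B" "x \<in> M B"
  shows "alt i t x = \<one>"
proof -
  have "act (transpose i t) x = x"
    using assms by (intro act_fix[OF permutes_swap_id]) (auto simp: transpose_def)
  then show ?thesis using assms M_carrier[OF assms(3)] by (auto simp: alt_def)
qed

lemma alts_alt_commute:
  assumes "i \<in> \<Omega>" "t \<in> \<Omega>" "x \<in> carrier G"
  shows "\<lbrakk>set L \<subseteq> \<Omega>; s ` set L \<subseteq> \<Omega>; i \<notin> set L \<union> s ` set L; t \<notin> set L \<union> s ` set L\<rbrakk>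
    \<Longrightarrow> alts L s (alt i t x) = alt i t (alts L s x)"
proof (induction L)
  case (Cons j L)
  interpret a: group_hom G G "alts L s" using Cons by (intro alts_hom) auto
  have j: "j \<in> \<Omega>" "s j \<in> \<Omega>" using Cons by auto
  interpret j: group_hom G G "alt j (s j)" by (rule alt_hom[OF j])
  let ?y = "alts L s x"
  have y: "?y \<in> carrier G" using assms by simp
  let ?a = "act (transpose i t)"
  have p: "transpose i t permutes \<Omega>" using assms by (intro permutes_swap_id)
  have "?a (alt j (s j) ?y) = alt j (s j) (?a ?y)"
    using act_alt[OF p j y] Cons.prems by (auto simp: transpose_def)
  then have "alt i t (alt j (s j) ?y) = alt j (s j) (alt i t ?y)"
    using y p by (simp add: alt_def[of i t] act_closed)
  then show ?case using Cons by simp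
qed simp

text \<open>Distinctness, injectivity and disjointness make the transpositions disjoint, so the
  factors commute and the one at \<open>i\<close> can be made to act first.\<close>

lemma alts_eq_one:
  assumes "x \<in> carrier G" "i \<in> set L" "alt i (t i) x = \<one>"
    and "set L \<subseteq> \<Omega>" "t ` set L \<subseteq> \<Omega>" "distinct L" "inj_on t (set L)" "t ` set L \<inter> set L = {}"
  shows "alts L t x = \<one>"
  using assms(2,4-)
proof (induction L)
  case (Cons j L)
  interpret a: group_hom G G "alts L t" using Cons by (intro alts_hom) auto
  interpret j: group_hom G G "alt j (t j)" using Cons by (intro alt_hom) auto
  show ?case
  proof (cases "i = j")
    case True
    have "alts L t (alt i (t i) x) = alt i (t i) (alts L t x)"
      using Cons.prems True assms(1) by (intro alts_alt_commute) (auto simp: inj_on_def)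
    then show ?thesis using True assms(3) by simp
  next
    case False
    then have "alts L t x = \<one>"
      using Cons.prems by (intro Cons.IH) (auto simp: inj_on_def)
    then show ?thesis by simp
  qed
qed simp

text \<open>A support of at most \<open>k\<close> points cannot meet more than \<open>k\<close>
  disjoint pairs \<open>{i, t i}\<close>, and the factor of a missed pair kills the
  generator.\<close>

lemma alts_long_eq_one:
  assumes "k < length L" "x \<in> carrier G"
    and L: "set L \<subseteq> \<Omega>" "t ` set L \<subseteq> \<Omega>" "distinct L" "inj_on t (set L)" "t ` set L \<inter> set L = {}"
  shows "alts L t x = \<one>"
proof -
  interpret a: group_hom G G "alts L t" using L by (intro alts_hom)
  have x: "x \<in> generate G (\<Union>{M U |U. U \<subseteq> \<Omega> \<and> card U \<le> k})"
    using M_generated assms by blast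
  show ?thesis
  proof (rule a.generate_le_kernel[OF _ x])
    fix y assume "y \<in> \<Union>{M U |U. U \<subseteq> \<Omega> \<and> card U \<le> k}"
    then obtain U where U: "y \<in> M U" "U \<subseteq> \<Omega>" "card U \<le> k" by blast
    have y: "y \<in> carrier G" using U M_carrier by blast
    have "\<exists>i\<in>set L. i \<notin> U \<and> t i \<notin> U"
    proof (rule ccontr)
      \<comment> \<open>Picks a point of \<open>U\<close> from each pair; it is injective because
        the pairs are disjoint.\<close>
      let ?f = "\<lambda>i. if i \<in> U then i else t i"
      assume "\<not> (\<exists>i\<in>set L. i \<notin> U \<and> t i \<notin> U)"
      then have "?f ` set L \<subseteq> U" by auto
      moreover have "inj_on ?f (set L)"
        using L by (auto simp: inj_on_def)
      ultimately have "card (set L) \<le> card U"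
        using U(2) finite_Omega card_inj_on_le finite_subset by metis
      then show False
        using assms(1) L(3) U(3) by (simp add: distinct_card)
    qed
    then obtain i where i: "i \<in> set L" "i \<notin> U" "t i \<notin> U" by blast
    then have "alt i (t i) y = \<one>"
      using U L by (intro alt_eq_one[of _ _ U]) auto
    then have "alts L t y = \<one>"
      using i y L by (intro alts_eq_one[of _ i]) auto
    with y show "y \<in> carrier G \<and> alts L t y = \<one>" by blast
  qed
qed

text \<open>The target of the recursion: a generator at \<open>i\<close> lacks \<open>i\<close>, so
  it is killed by the alternator of \<open>i\<close> with any partner outside
  \<open>F i\<close>.\<close>

definition drop_span :: "('i \<Rightarrow> 'i set) \<Rightarrow> 'i set \<Rightarrow> 'a set"
  where "drop_span F I = generate G (\<Union>i\<in>I. V (F i - {i}))"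

lemma drop_span_generators:
  "(\<And>i. i \<in> I \<Longrightarrow> F i \<subseteq> \<Omega>) \<Longrightarrow> (\<Union>i\<in>I. V (F i - {i})) \<subseteq> carrier G"
  using V_carrier by (meson Diff_subset UN_least order_trans subsetI)

lemma drop_span_subgroup: "(\<And>i. i \<in> I \<Longrightarrow> F i \<subseteq> \<Omega>) \<Longrightarrow> subgroup (drop_span F I) G"
  unfolding drop_span_def by (intro generate_is_subgroup drop_span_generators)

lemma drop_span_incl: "\<lbrakk>i \<in> I; x \<in> V (F i - {i})\<rbrakk> \<Longrightarrow> x \<in> drop_span F I"
  unfolding drop_span_def by (intro generate.incl) blast

lemma drop_span_mono: "I \<subseteq> J \<Longrightarrow> drop_span F I \<subseteq> drop_span F J"
  unfolding drop_span_def by (intro mono_generate) blast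

text \<open>Expanding the product and using that its factor for the earliest \<open>i\<close> that occurs
  in a term moves the term into \<open>V (F i - {i})\<close>.\<close>

lemma alts_expand:
  assumes A: "A \<subseteq> \<Omega>" "x \<in> V A"
  shows "\<lbrakk>set L \<subseteq> A; distinct L; inj_on m (set L);
     \<And>i. i \<in> set L \<Longrightarrow> A \<subseteq> F i \<and> F i \<subseteq> \<Omega> \<and> m i \<in> F i - A;
     sorted_wrt (\<lambda>i j. F i \<subseteq> F j) L\<rbrakk>
    \<Longrightarrow> x \<otimes> inv alts L m x \<in> drop_span F (set L)"
proof (induction L)
  case Nil
  show ?case using V_carrier[OF A] by (simp add: drop_span_def generate.one)
next
  case (Cons i L)
  let ?Q = "drop_span F (set L)" and ?Q' = "drop_span F (set (i # L))"
  let ?y = "alts L m x" and ?a = "act (transpose i (m i))"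
  have x: "x \<in> carrier G" using V_carrier[OF A] .
  have i: "i \<in> \<Omega>" "m i \<in> \<Omega>" "i \<in> A" using Cons.prems A by auto
  interpret L: group_hom G G "alts L m" using Cons.prems A by (intro alts_hom) auto
  have p: "transpose i (m i) permutes \<Omega>" using i by (intro permutes_swap_id)
  interpret a: group_hom G G ?a by (rule act_group_hom[OF p])
  interpret Q': subgroup ?Q' G using Cons.prems by (intro drop_span_subgroup) auto
  have IH: "x \<otimes> inv ?y \<in> ?Q" using Cons by auto
  \<comment> \<open>Both \<open>i\<close> and \<open>m i\<close> lie in
    \<open>F i \<subseteq> F j\<close>, and both differ from \<open>j\<close>, as the list is
    distinct and \<open>m i\<close> is outside \<open>A\<close>. So the transposition permutes
    \<open>F j - {j}\<close> and preserves \<open>?Q\<close>.\<close>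
  have "?a ` (\<Union>j\<in>set L. V (F j - {j})) \<subseteq> (\<Union>j\<in>set L. V (F j - {j}))"
  proof clarify
    fix j z assume j: "j \<in> set L" and z: "z \<in> V (F j - {j})"
    have F: "F i \<subseteq> F j" "F j \<subseteq> \<Omega>" using Cons.prems j by auto
    have "A \<subseteq> F j" "m i \<in> F i - A" "j \<in> A" using Cons.prems j by auto
    then have "i \<in> F j - {j}" "m i \<in> F j - {j}" using Cons.prems(2) i j F by auto
    then have "transpose i (m i) ` (F j - {j}) = F j - {j}"
      by (intro permutes_image permutes_swap_id)
    moreover have "?a z \<in> V (transpose i (m i) ` (F j - {j}))"
      using F z by (intro act_V[OF p]) auto
    ultimately show "?a z \<in> (\<Union>j\<in>set L. V (F j - {j}))" using j by auto
  qed
  moreover have "(\<Union>j\<in>set L. V (F j - {j})) \<subseteq> carrier G"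
    using Cons.prems(4) by (intro drop_span_generators) simp
  ultimately have "?a ` ?Q \<subseteq> ?Q"
    unfolding drop_span_def by (simp only: mono_generate flip: a.generate_img)
  then have 1: "?a (x \<otimes> inv ?y) \<in> ?Q'" "x \<otimes> inv ?y \<in> ?Q'"
    using IH drop_span_mono[of "set L" "set (i # L)" F] by auto
  have "m i \<in> F i - A" "A \<subseteq> F i" using Cons.prems(4) by auto
  then have "transpose i (m i) ` A \<subseteq> F i - {i}"
    using i by (auto simp: transpose_def)
  then have "?a x \<in> V (F i - {i})"
    using act_V[OF p A] V_mono[of "transpose i (m i) ` A" "F i - {i}"] Cons.prems by auto
  then have 2: "?a x \<in> ?Q'" by (intro drop_span_incl[of i]) auto
  \<comment> \<open>Additively, with \<open>a\<close> the transposition: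
    \<open>x - (1 - a) y = (x - y) + (a x - a (x - y))\<close>.\<close>
  have eq: "x \<otimes> inv alts (i # L) m x = (x \<otimes> inv ?y) \<otimes> (?a x \<otimes> inv ?a (x \<otimes> inv ?y))"
  proof -
    have "?a x \<otimes> inv ?a (x \<otimes> inv ?y) = ?a ?y"
      using x by (simp add: inv_mult flip: m_assoc)
    then show ?thesis using x by (simp add: alt_def inv_mult m_assoc)
  qed
  show ?case unfolding eq by (intro Q'.m_closed Q'.m_inv_closed 1 2)
qed
text \<open>The update changes only the generators at \<open>b\<close>, which form the subgroup
  \<open>V (A - {b})\<close>; in an abelian group a product of two subgroups is a subgroup.\<close>

lemma drop_span_insert:
  assumes "b \<notin> I" "A \<subseteq> \<Omega>" "\<And>i. i \<in> I \<Longrightarrow> F i \<subseteq> \<Omega>" "x \<in> drop_span (F(b := A)) (insert b I)"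
  obtains q z where "q \<in> drop_span F I" "z \<in> V (A - {b})" "x = q \<otimes> z"
proof -
  have Q: "subgroup (drop_span F I) G" using assms(3) by (rule drop_span_subgroup)
  have V: "subgroup (V (A - {b})) G" using assms(2) by (intro V_subgroup) auto
  have "drop_span (F(b := A)) (insert b I) \<subseteq> drop_span F I <#> V (A - {b})"
    unfolding drop_span_def[of "F(b := A)"]
  proof (intro generate_subgroup_incl mult_subgroups Q V subsetI)
    fix y assume "y \<in> (\<Union>i\<in>insert b I. V ((F(b := A)) i - {i}))"
    then consider "y \<in> V (A - {b})" | "y \<in> drop_span F I"
      using assms(1) by (auto intro: drop_span_incl split: if_splits)
    then show "y \<in> drop_span F I <#> V (A - {b})"
    proof cases
      case 1
      then show ?thesis
        using subgroup.one_closed[OF Q] subgroup.mem_carrier[OF V]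
        by (force simp: set_mult_def)
    next
      case 2
      then show ?thesis
        using subgroup.one_closed[OF V] subgroup.mem_carrier[OF Q]
        by (force simp: set_mult_def)
    qed
  qed
  then show thesis using assms(4) that by (auto simp: set_mult_def)
qed

text \<open>The list \<open>L\<close> records (latest first) points \<open>i\<close> that are still in the support \<open>A\<close>
  and whose alternator annihilates \<open>x\<close>; \<open>F i\<close> is the support at the time \<open>i\<close> was chosen.
  Points of \<open>T - A\<close> have been eliminated since, and the injection \<open>m\<close> matches each of
  them to a point of \<open>D \<subseteq> L\<close> chosen earlier. As long as some point of \<open>L\<close> is unmatched,
  any further point of \<open>A\<close> may first be added to \<open>L\<close> and then be eliminated.\<close>

lemma alternated_in_drop_span:
  assumes T: "T \<subseteq> \<Omega>" "inj_on \<tau> T" "\<tau> ` T \<subseteq> \<Omega> - T" "min k d + d < card T"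
  shows "\<lbrakk>distinct L; set L \<subseteq> A; A \<subseteq> T; \<And>i. i \<in> set L \<Longrightarrow> A \<subseteq> F i \<and> F i \<subseteq> T;
     sorted_wrt (\<lambda>i j. F i \<subseteq> F j) L; D \<subseteq> set L; inj_on m D; \<And>i. i \<in> D \<Longrightarrow> m i \<in> F i - A;
     card D = card (T - A); x \<in> V A; alts L \<tau> x = \<one>\<rbrakk> \<Longrightarrow> x \<in> drop_span F (set L)"
\<comment> \<open>The measure drops both when a point of \<open>A\<close> joins \<open>L\<close> and
  when a point outside \<open>L\<close> leaves \<open>A\<close>.\<close>
proof (induction "card (A - set L)" arbitrary: L F A D m x rule: less_induct)
  case less
  note prems = less.prems
  have F\<Omega>: "F i \<subseteq> \<Omega>" if "i \<in> set L" for i using prems(4) T(1) that by blast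
  have A\<Omega>: "A \<subseteq> \<Omega>" and L\<Omega>: "set L \<subseteq> \<Omega>" using prems(2,3) T(1) by blast+
  have finT: "finite T" using finite_subset[OF T(1) finite_Omega] .
  have finA: "finite A" using finite_subset[OF A\<Omega> finite_Omega] .
  have x: "x \<in> carrier G" using V_carrier[OF A\<Omega> prems(10)] .
  let ?Q = "drop_span F (set L)"
  interpret Q: subgroup ?Q G using F\<Omega> by (rule drop_span_subgroup)
  have \<tau>L: "\<tau> ` set L \<subseteq> \<Omega>" "\<tau> ` set L \<inter> T = {}" using T(3) prems(2,3) by blast+
  have inj\<tau>: "inj_on \<tau> (set L)" using T(2) prems(2,3) by (meson inj_on_subset)
  interpret L: group_hom G G "alts L \<tau>" using L\<Omega> \<tau>L by (intro alts_hom)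
  \<comment> \<open>By \<open>alts_expand\<close> it suffices to kill \<open>x\<close> by a product
    over matched points whose partners are given by \<open>m\<close>.\<close>
  have expand: ?case if K: "set K \<subseteq> D" "distinct K" "sorted_wrt (\<lambda>i j. F i \<subseteq> F j) K"
    and one: "alts K m x = \<one>" for K
  proof -
    have KL: "set K \<subseteq> set L" using K(1) prems(6) by blast
    have "x \<otimes> inv alts K m x \<in> drop_span F (set K)"
    proof (rule alts_expand[OF A\<Omega> prems(10)])
      fix i assume "i \<in> set K"
      then show "A \<subseteq> F i \<and> F i \<subseteq> \<Omega> \<and> m i \<in> F i - A"
        using K(1) KL prems(4,8) F\<Omega> by blast
    qed (use K KL prems in \<open>auto intro: inj_on_subset\<close>)
    moreover have "drop_span F (set K) \<subseteq> ?Q"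
      using K prems by (intro drop_span_mono) auto
    ultimately show ?thesis using one x by auto
  qed
  consider "D = set L" | "k < card D" | "d < length L"
    | "D \<noteq> set L" "card D \<le> k" "length L \<le> d" by linarith
  then show ?case
  proof cases
    case 1
    \<comment> \<open>Everything is matched: a permutation fixing \<open>A\<close> pointwise, hence
      fixing \<open>x\<close>, replaces each fresh partner \<open>\<tau> i\<close> by
      \<open>m i\<close>.\<close>
    let ?f = "\<lambda>a. if a \<in> A then a else m (the_inv_into (set L) \<tau> a)"
    have disj: "\<tau> ` set L \<inter> A = {}" using \<tau>L prems(3) by blast
    have f: "?f (\<tau> i) = m i" if "i \<in> set L" for i
      using that disj inj\<tau> by (auto simp: the_inv_into_f_f)
    have "inj_on ?f (A \<union> \<tau> ` set L)"
    proof (rule inj_onI)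
      fix a b assume ab: "a \<in> A \<union> \<tau> ` set L" "b \<in> A \<union> \<tau> ` set L" and eq: "?f a = ?f b"
      have m: "m i \<notin> A" if "i \<in> set L" for i using prems(8) 1 that by auto
      show "a = b"
      proof (cases "a \<in> A \<or> b \<in> A")
        case True
        then show ?thesis using ab eq f m by (metis UnE imageE)
      next
        case False
        then obtain i j where ij: "a = \<tau> i" "b = \<tau> j" "i \<in> set L" "j \<in> set L" using ab by blast
        then have "m i = m j" using eq f by metis
        then show ?thesis using ij prems(7) 1 by (simp add: inj_on_eq_iff)
      qed
    qed
    moreover have "?f ` (A \<union> \<tau> ` set L) \<subseteq> \<Omega>"
    proof -
      have "?f (\<tau> i) \<in> \<Omega>" if "i \<in> set L" for i
        using f[OF that] prems(8) 1 F\<Omega>[OF that] that by auto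
      moreover have "?f a \<in> \<Omega>" if "a \<in> A" for a
        using A\<Omega> that by auto
      ultimately show ?thesis by blast
    qed
    ultimately obtain \<sigma> where \<sigma>: "\<sigma> permutes \<Omega>" "\<And>a. a \<in> A \<union> \<tau> ` set L \<Longrightarrow> \<sigma> a = ?f a"
      using inj_on_extend_permutation[OF finite_Omega, of "A \<union> \<tau> ` set L" ?f] A\<Omega> \<tau>L(1) by blast
    interpret s: group_hom G G "act \<sigma>" by (rule act_group_hom[OF \<sigma>(1)])
    have "act \<sigma> x = x"
      using \<sigma> prems(10) V_le_M[OF A\<Omega>] by (intro act_fix[OF \<sigma>(1) A\<Omega>]) auto
    moreover have "act \<sigma> (alts L \<tau> x) = alts L m (act \<sigma> x)"
    proof (rule act_alts[OF \<sigma>(1) x L\<Omega> \<tau>L(1)])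
      fix i assume i: "i \<in> set L"
      then show "\<sigma> i = i \<and> \<sigma> (\<tau> i) = m i"
        using \<sigma>(2)[of i] \<sigma>(2)[of "\<tau> i"] f[OF i] prems(2) by auto
    qed
    ultimately have "alts L m x = \<one>" using prems(11) by simp
    then show ?thesis using 1 prems by (intro expand[of L]) auto
  next
    case 2
    \<comment> \<open>More than \<open>k\<close> points are matched, so their product kills all of
      the group.\<close>
    let ?K = "filter (\<lambda>i. i \<in> D) L"
    have K: "set ?K = D" using prems(6) by auto
    have dK: "distinct ?K" using prems(1) by simp
    have mD: "m i \<in> \<Omega> - A" if "i \<in> D" for i
      using prems(6,8) F\<Omega> that by blast
    have "alts ?K m x = \<one>"
    proof (rule alts_long_eq_one)
      show "k < length ?K" using 2 K dK by (metis distinct_card)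
      show "m ` set ?K \<inter> set ?K = {}" using mD prems(2,6) K by auto
    qed (use K dK mD prems(6,7) L\<Omega> x in auto)
    then show ?thesis
      using K dK prems(5) by (intro expand[of ?K]) (auto intro: sorted_wrt_filter)
  next
    case 3
    \<comment> \<open>A generator of \<open>V\<close> on at most \<open>d\<close> points misses some
      \<open>i\<close> of the longer list \<open>L\<close>.\<close>
    have "generate G (\<Union>{V U |U. U \<subseteq> A \<and> card U \<le> d}) \<subseteq> ?Q"
    proof (intro generate_subgroup_incl Q.subgroup_axioms subsetI)
      fix y assume "y \<in> \<Union>{V U |U. U \<subseteq> A \<and> card U \<le> d}"
      then obtain U where U: "y \<in> V U" "U \<subseteq> A" "card U \<le> d" by blast
      have "\<not> set L \<subseteq> U"
        using 3 U card_mono[of U "set L"] finite_subset[OF U(2) finA] distinct_card[OF prems(1)]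
        by auto
      then obtain i where i: "i \<in> set L" "i \<notin> U" by blast
      then have "y \<in> V (F i - {i})"
        using V_mono[of U "F i - {i}"] U prems(4)[OF i(1)] F\<Omega>[OF i(1)] by blast
      with i(1) show "y \<in> ?Q" by (rule drop_span_incl)
    qed
    then show ?thesis using V_generated[OF A\<Omega>] prems(10) by blast
  next
    case 4
    have "card D < length L"
      using 4(1) prems(1,6) by (metis List.finite_set distinct_card psubsetI psubset_card_mono)
    moreover have "card T = card A + card D"
      using prems(3,9) card_Diff_subset[OF finA prems(3)] card_mono[OF finT prems(3)] by simp
    \<comment> \<open>As \<open>card D < length L \<le> d\<close>, \<open>card D\<close> is at most
      \<open>min k d\<close>, so \<open>card A = card T - card D\<close> exceeds \<open>d\<close>.
      This leaves a point \<open>b\<close> to choose.\<close>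
    ultimately have "card (set L) < card A"
      using 4 T(4) distinct_card[OF prems(1)] by linarith
    then have "A - set L \<noteq> {}" using prems(2) by auto
    then obtain b where b: "b \<in> A" "b \<notin> set L" by blast
    have bL: "b \<notin> D" "b \<in> \<Omega>" "\<tau> b \<in> \<Omega>" using b prems(3,6) T(3) A\<Omega> by blast+
    have dec: "card (A - insert b (set L)) < card (A - set L)"
      using b finA by (intro psubset_card_mono) auto
    interpret b: group_hom G G "alt b (\<tau> b)" using bL by (intro alt_hom)
    \<comment> \<open>First recursive call: \<open>b\<close> joins \<open>L\<close>, with the
      present support \<open>A\<close> recorded for it.\<close>
    have chosen: "x \<in> drop_span (F(b := A)) (set (b # L))"
    proof (rule less.hyps[of A "b # L" "F(b := A)" D m])
      show "A \<subseteq> (F(b := A)) i \<and> (F(b := A)) i \<subseteq> T" if "i \<in> set (b # L)" for i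
        using that prems(3,4) by auto
      show "m i \<in> (F(b := A)) i - A" if "i \<in> D" for i
        using that prems(8)[of i] bL(1) by auto
      show "sorted_wrt (\<lambda>i j. (F(b := A)) i \<subseteq> (F(b := A)) j) (b # L)"
        using prems(4,5) b(2) by (auto simp: sorted_wrt_iff_nth_less nth_Cons' split: if_splits)
      show "alts (b # L) \<tau> x = \<one>" using prems(11) by simp
    qed (use dec b bL prems in auto)
    then obtain q z where q: "q \<in> ?Q" and z: "z \<in> V (A - {b})" and xqz: "x = q \<otimes> z"
      using drop_span_insert[OF b(2) A\<Omega> F\<Omega> chosen[unfolded list.set]] by blast
    have qG: "q \<in> carrier G" and zG: "z \<in> carrier G"
      using Q.mem_carrier[OF q] V_carrier[OF _ z] A\<Omega> by auto
    \<comment> \<open>Each generator of \<open>?Q\<close> lacks some \<open>i\<close> and also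
      \<open>\<tau> i\<close>, which is outside \<open>T\<close>. Hence \<open>z\<close> inherits
      the annihilation from \<open>x\<close>.\<close>
    have "alts L \<tau> q = \<one>"
    proof (rule L.generate_le_kernel[OF _ q[unfolded drop_span_def]])
      fix y assume "y \<in> (\<Union>i\<in>set L. V (F i - {i}))"
      then obtain i where i: "i \<in> set L" "y \<in> V (F i - {i})" by blast
      have sub: "F i - {i} \<subseteq> \<Omega>" using F\<Omega>[OF i(1)] by blast
      have y: "y \<in> carrier G" using V_carrier[OF sub i(2)] .
      have "alt i (\<tau> i) y = \<one>"
        using i sub V_le_M[OF sub] L\<Omega> \<tau>L prems(4)[OF i(1)]
        by (intro alt_eq_one[of _ _ "F i - {i}"]) auto
      moreover have "\<tau> ` set L \<inter> set L = {}" using \<tau>L(2) prems(2,3) by blast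
      ultimately have "alts L \<tau> y = \<one>"
        using i(1) y L\<Omega> \<tau>L(1) prems(1) inj\<tau> by (intro alts_eq_one[of _ i])
      then show "y \<in> carrier G \<and> alts L \<tau> y = \<one>" using y by blast
    qed
    then have z1: "alts L \<tau> z = \<one>" using prems(11) xqz qG zG by simp
    obtain i where i: "i \<in> set L" "i \<notin> D" using 4(1) prems(6) by blast
    have "z \<in> ?Q"
    \<comment> \<open>Second recursive call: \<open>b\<close> has left the support of
      \<open>z\<close> and becomes the match of \<open>i\<close>, as
      \<open>b \<in> A \<subseteq> F i\<close>.\<close>
    proof (rule less.hyps[of "A - {b}" L F "insert i D" "m(i := b)"])
      show "card (A - {b} - set L) < card (A - set L)"
        using dec unfolding Diff_insert2[of A b "set L"] .
      have "m j \<noteq> b" if "j \<in> D" for j using prems(8)[OF that] b(1) by fastforce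
      then have "b \<notin> m ` D" by blast
      then show "inj_on (m(i := b)) (insert i D)"
        using i prems(7) by (auto simp: inj_on_def)
      have "finite D" using prems(6) finite_subset by blast
      moreover have "T - (A - {b}) = insert b (T - A)" using b(1) prems(3) by blast
      ultimately show "card (insert i D) = card (T - (A - {b}))"
        using i prems(9) b(1) finT by simp
      show "(m(i := b)) j \<in> F j - (A - {b})" if "j \<in> insert i D" for j
        using that i b(1) prems(4)[OF i(1)] prems(8) by auto
    qed (use i b z z1 prems in auto)
    then show ?thesis using q xqz by simp
  qed
qed

text \<open>The recursion starts from \<open>[c]\<close> with support \<open>T\<close> and the empty
  matching; over a single index the span reduces to \<open>V (T - {c})\<close>.\<close>

lemma M_inter_V_step:
  assumes T: "T \<subseteq> \<Omega>" "inj_on \<tau> T" "\<tau> ` T \<subseteq> \<Omega> - T" "min k d + d < card T"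
    and c: "c \<in> T" and x: "x \<in> M (T - {c})" "x \<in> V T"
  shows "x \<in> V (T - {c})"
proof -
  have sub: "T - {c} \<subseteq> \<Omega>" using T by blast
  have "alt c (\<tau> c) x = \<one>"
    using T c x by (intro alt_eq_one[of _ _ "T - {c}"]) auto
  then have "x \<in> drop_span (\<lambda>_. T) (set [c])"
    using T c x by (intro alternated_in_drop_span[where T = T and \<tau> = \<tau> and A = T and D = "{}"]) auto
  moreover have "generate G (V (T - {c})) \<subseteq> V (T - {c})"
    by (intro generate_subgroup_incl V_subgroup sub) simp
  ultimately show ?thesis by (auto simp: drop_span_def)
qed

text \<open>Points of \<open>T - S\<close> are removed one at a time; before each removal the
  current set properly contains \<open>S\<close>, which gives the strict bound on its size.\<close>

lemma M_inter_V:
  assumes T: "T \<subseteq> \<Omega>" "inj_on \<tau> T" "\<tau> ` T \<subseteq> \<Omega> - T"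
    and S: "S \<subseteq> T" "min k d + d \<le> card S" and x: "x \<in> M S"
  shows "x \<in> V T \<Longrightarrow> x \<in> V S"
  using T S(1)
proof (induction "card (T - S)" arbitrary: T)
  case 0
  have "finite T" using 0 finite_Omega finite_subset by metis
  then show ?case using 0 by (metis Diff_eq_empty_iff card_0_eq finite_Diff subset_antisym)
next
  case (Suc n)
  have finT: "finite T" using Suc finite_Omega finite_subset by metis
  obtain c where c: "c \<in> T" "c \<notin> S" using Suc.hyps(2) by (metis Diff_iff card.empty ex_in_conv nat.distinct(1))
  have "card S < card T" using c Suc.prems finT by (intro psubset_card_mono) auto
  moreover have "x \<in> M (T - {c})"
    using M_mono[of S "T - {c}"] Suc.prems c x by blast
  ultimately have "x \<in> V (T - {c})"
    using Suc.prems c S x by (intro M_inter_V_step[where \<tau> = \<tau>]) auto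
  moreover have "n = card (T - {c} - S)"
  proof -
    have "T - {c} - S = (T - S) - {c}" by blast
    then show ?thesis using Suc.hyps(2) c finT by simp
  qed
  ultimately show ?case using Suc.prems c by (intro Suc.hyps(1)[of "T - {c}"]) (auto intro: inj_on_subset)
qed

end

subsection \<open>The filtration of \<open>M\<^sub>\<Omega>\<close> by images\<close>

lemma FI_hom_inclusion: "A \<subseteq> B \<Longrightarrow> (\<lambda>i\<in>A. i) \<in> FI_hom A B"
  by (auto simp: FI_hom_def inj_on_def)

lemma FI_hom_weaken: "\<lbrakk>f \<in> FI_hom S T; T \<subseteq> U\<rbrakk> \<Longrightarrow> f \<in> FI_hom S U"
  by (auto simp: FI_hom_def PiE_iff)

lemma FI_hom_inv_into:
  assumes "f \<in> FI_hom S T"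
  shows "(\<lambda>i\<in>f ` S. inv_into S f i) \<in> FI_hom (f ` S) S"
  using assms by (auto simp: FI_hom_def inj_on_def inv_into_into f_inv_into_f)

lemma FI_hom_restrict: "\<lbrakk>\<sigma> permutes \<Omega>; B \<subseteq> \<Omega>\<rbrakk> \<Longrightarrow> restrict \<sigma> B \<in> FI_hom B (\<sigma> ` B)"
  by (auto simp: FI_hom_def intro: inj_on_subset[OF permutes_inj])

lemma compose_inclusion: "\<lbrakk>f \<in> FI_hom S T; T \<subseteq> U\<rbrakk> \<Longrightarrow> compose S (\<lambda>i\<in>T. i) f = f"
  by (auto simp: FI_hom_def compose_def fun_eq_iff PiE_iff extensional_def)

text \<open>Places all values in one group. Applied to \<open>FI_sub W V\<close>, which shares
  \<open>ind\<close> with \<open>W\<close>, it places \<open>V\<close> there too.\<close>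

definition FI_img :: "'a FI_functor \<Rightarrow> nat set \<Rightarrow> nat set \<Rightarrow> 'a set"
  where "FI_img W \<Omega> A = ind W A \<Omega> (\<lambda>i\<in>A. i) ` carrier (ob W A)"

context FI_module
begin

lemma ind_closed: "\<lbrakk>finite S; finite T; f \<in> FI_hom S T; x \<in> carrier (ob W S)\<rbrakk>
    \<Longrightarrow> ind W S T f x \<in> carrier (ob W T)"
  by (rule hom_in_carrier[OF ind_hom])

lemma ind_group_hom:
  assumes "finite S" "finite T" "f \<in> FI_hom S T"
  shows "group_hom (ob W S) (ob W T) (ind W S T f)"
proof -
  interpret S: comm_group "ob W S" using ob_comm_group[OF assms(1)] .
  interpret T: comm_group "ob W T" using ob_comm_group[OF assms(2)] .
  show ?thesis by unfold_locales (rule ind_hom[OF assms])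
qed

lemma ind_inclusion:
  assumes "finite U" "T \<subseteq> U" "finite S" "f \<in> FI_hom S T" "x \<in> carrier (ob W S)"
  shows "ind W T U (\<lambda>i\<in>T. i) (ind W S T f x) = ind W S U f x"
  using ind_compose[of S T U f "\<lambda>i\<in>T. i" x] assms finite_subset[OF assms(2,1)]
  by (simp add: FI_hom_inclusion compose_inclusion)

lemma ind_in_FI_img:
  assumes "finite \<Omega>" "finite S" "f \<in> FI_hom S \<Omega>" "x \<in> carrier (ob W S)"
  shows "ind W S \<Omega> f x \<in> FI_img W \<Omega> (f ` S)"
proof -
  have f: "f \<in> FI_hom S (f ` S)" "f ` S \<subseteq> \<Omega>" using assms(3) by (auto simp: FI_hom_def)
  then have "ind W S \<Omega> f x = ind W (f ` S) \<Omega> (\<lambda>i\<in>f ` S. i) (ind W S (f ` S) f x)"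
    using assms by (simp add: ind_inclusion)
  then show ?thesis
    unfolding FI_img_def using assms f(1) by (simp add: ind_closed)
qed

lemma FI_img_mono: "\<lbrakk>finite \<Omega>; A \<subseteq> B; B \<subseteq> \<Omega>\<rbrakk> \<Longrightarrow> FI_img W \<Omega> A \<subseteq> FI_img W \<Omega> B"
proof
  fix x assume A: "finite \<Omega>" "A \<subseteq> B" "B \<subseteq> \<Omega>" and "x \<in> FI_img W \<Omega> A"
  then obtain y where y: "y \<in> carrier (ob W A)" "x = ind W A \<Omega> (\<lambda>i\<in>A. i) y"
    by (auto simp: FI_img_def)
  have fin: "finite B" "finite A"
    using finite_subset[OF A(3,1)] finite_subset[OF order_trans[OF A(2,3)] A(1)] .
  have "x = ind W B \<Omega> (\<lambda>i\<in>B. i) (ind W A B (\<lambda>i\<in>A. i) y)"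
    using A y fin by (simp add: ind_inclusion FI_hom_inclusion)
  then show "x \<in> FI_img W \<Omega> B"
    unfolding FI_img_def using A y fin by (auto intro!: ind_closed FI_hom_inclusion)
qed

lemma FI_img_subgroup:
  assumes "finite \<Omega>" "A \<subseteq> \<Omega>"
  shows "subgroup (FI_img W \<Omega> A) (ob W \<Omega>)"
proof -
  interpret group_hom "ob W A" "ob W \<Omega>" "ind W A \<Omega> (\<lambda>i\<in>A. i)"
    using assms finite_subset by (intro ind_group_hom FI_hom_inclusion) auto
  show ?thesis unfolding FI_img_def by (rule img_is_subgroup)
qed

lemma ind_permutation_FI_img:
  assumes "finite \<Omega>" "\<sigma> permutes \<Omega>" "A \<subseteq> \<Omega>" "y \<in> carrier (ob W A)"
  shows "ind W \<Omega> \<Omega> (restrict \<sigma> \<Omega>) (ind W A \<Omega> (\<lambda>i\<in>A. i) y) = ind W A \<Omega> (restrict \<sigma> A) y"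
proof -
  have "compose A (restrict \<sigma> \<Omega>) (\<lambda>i\<in>A. i) = restrict \<sigma> A"
    using assms(3) by (auto simp: compose_def fun_eq_iff)
  moreover have "restrict \<sigma> \<Omega> \<in> FI_hom \<Omega> \<Omega>"
    using FI_hom_restrict[OF assms(2) order_refl] permutes_image[OF assms(2)] by simp
  ultimately show ?thesis
    using assms ind_compose[of A \<Omega> \<Omega> "\<lambda>i\<in>A. i" "restrict \<sigma> \<Omega>" y] finite_subset[OF assms(3,1)]
    by (simp add: FI_hom_inclusion)
qed

text \<open>The degree only tests the sets \<open>{1..n}\<close>; the result there is carried to
  \<open>T\<close> along a bijection, since the span is a sub-FI-module.\<close>

lemma carrier_le_span_from_smaller:
  assumes gen: "generated_in_degree_le W m" and T: "finite T" "m < card T"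
  shows "carrier (ob W T) \<subseteq> span_from_smaller W T"
proof
  interpret H: sub_FI_module W "span_from_smaller W" by (rule sub_FI_module_span_from_smaller)
  let ?n = "{1..card T}"
  \<comment> \<open>An infimum strictly below \<open>card T\<close> yields an admissible bound below
    \<open>card T\<close>.\<close>
  have "FI_degree (FI_H0 W) < ereal (real (card T))"
    using gen T(2) order_le_less_trans[of _ "ereal (real m)" "ereal (real (card T))"]
    by (simp add: generated_in_degree_le_def)
  then have triv: "carrier (ob (FI_H0 W) ?n) = {\<one>\<^bsub>ob (FI_H0 W) ?n\<^esub>}"
    unfolding FI_degree_def Inf_less_iff by blast
  have n: "x \<in> span_from_smaller W ?n" if x: "x \<in> carrier (ob W ?n)" for x
  proof -
    interpret N: comm_group "ob W ?n" by (rule ob_comm_group) simp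
    have S: "subgroup (span_from_smaller W ?n) (ob W ?n)" by (rule H.sub_subgroup) simp
    have "span_from_smaller W ?n #>\<^bsub>ob W ?n\<^esub> x = span_from_smaller W ?n"
      using triv x H.carrier_FI_quot[of ?n] by (auto simp: FI_H0_def FI_quot_def FactGroup_def)
    then show ?thesis using N.rcos_self[OF x S] by simp
  qed
  fix x assume x: "x \<in> carrier (ob W T)"
  obtain g where g: "bij_betw g T ?n"
    using finite_same_card_bij[of T ?n] T(1) by auto
  let ?g = "restrict g T" and ?h = "\<lambda>i\<in>?n. inv_into T g i"
  have g': "?g \<in> FI_hom T ?n" using g by (auto simp: FI_hom_def bij_betw_def)
  have h': "?h \<in> FI_hom ?n T"
    using bij_betw_inv_into[OF g] by (auto simp: FI_hom_def bij_betw_def)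
  have "compose T ?h ?g = (\<lambda>i\<in>T. i)"
    using g by (auto simp: compose_def fun_eq_iff bij_betw_def)
  then have "ind W ?n T ?h (ind W T ?n ?g x) = x"
    using ind_compose[OF T(1) _ T(1) g' h' x] ind_id[OF T(1) x] by simp
  moreover have "ind W T ?n ?g x \<in> span_from_smaller W ?n"
    using T(1) g' x by (intro n ind_closed) auto
  ultimately show "x \<in> span_from_smaller W T"
    using H.sub_ind[of ?n T ?h] T(1) h' by (metis finite_atLeastAtMost)
qed

lemma FI_img_generated:
  assumes gen: "generated_in_degree_le W m" and \<Omega>: "finite \<Omega>"
  shows "A \<subseteq> \<Omega> \<Longrightarrow>
    FI_img W \<Omega> A \<subseteq> generate (ob W \<Omega>) (\<Union>{FI_img W \<Omega> U |U. U \<subseteq> A \<and> card U \<le> m})"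
proof (induction "card A" arbitrary: A rule: less_induct)
  case less
  interpret O: comm_group "ob W \<Omega>" using ob_comm_group[OF \<Omega>] .
  have A: "finite A" using less.prems \<Omega> finite_subset by blast
  interpret h: group_hom "ob W A" "ob W \<Omega>" "ind W A \<Omega> (\<lambda>i\<in>A. i)"
    using A \<Omega> less.prems by (intro ind_group_hom FI_hom_inclusion)
  let ?gen = "\<lambda>A. \<Union>{FI_img W \<Omega> U |U. U \<subseteq> A \<and> card U \<le> m}"
  show ?case
  proof (cases "card A \<le> m")
    case True
    then show ?thesis by (auto intro!: generate.incl)
  next
    case False
    let ?S = "\<Union>{ind W S A f ` carrier (ob W S) |S f. finite S \<and> card S < card A \<and> f \<in> FI_hom S A}"
    have "FI_img W \<Omega> U \<subseteq> carrier (ob W \<Omega>)" if "U \<subseteq> \<Omega>" for U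
      by (rule subgroup.subset[OF FI_img_subgroup[OF \<Omega> that]])
    then have "?gen A \<subseteq> carrier (ob W \<Omega>)"
      using less.prems by blast
    then have sub: "subgroup (generate (ob W \<Omega>) (?gen A)) (ob W \<Omega>)"
      by (rule O.generate_is_subgroup)
    have "?S \<subseteq> carrier (ob W A)" using ind_closed A by auto
    then have "FI_img W \<Omega> A \<subseteq> generate (ob W \<Omega>) (ind W A \<Omega> (\<lambda>i\<in>A. i) ` ?S)"
      unfolding FI_img_def using carrier_le_span_from_smaller[OF gen A] False
      by (simp only: h.generate_img) (auto simp: span_from_smaller_def)
    also have "\<dots> \<subseteq> generate (ob W \<Omega>) (?gen A)"
    proof (rule O.generate_subgroup_incl[OF _ sub], rule subsetI)
      fix z assume "z \<in> ind W A \<Omega> (\<lambda>i\<in>A. i) ` ?S"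
      then obtain S f y where S: "finite S" "card S < card A" "f \<in> FI_hom S A"
        and y: "y \<in> carrier (ob W S)" and z: "z = ind W A \<Omega> (\<lambda>i\<in>A. i) (ind W S A f y)" by blast
      have fS: "f ` S \<subseteq> A" "card (f ` S) < card A"
        using S by (auto simp: FI_hom_def card_image)
      have "z \<in> FI_img W \<Omega> (f ` S)"
        unfolding z ind_inclusion[OF \<Omega> less.prems S(1,3) y]
        by (rule ind_in_FI_img[OF \<Omega> S(1) FI_hom_weaken[OF S(3) less.prems] y])
      then have "z \<in> generate (ob W \<Omega>) (?gen (f ` S))"
        using less.hyps[OF fS(2) order_trans[OF fS(1) less.prems]] by blast
      moreover have "generate (ob W \<Omega>) (?gen (f ` S)) \<subseteq> generate (ob W \<Omega>) (?gen A)"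
        by (intro O.mono_generate Union_mono Collect_mono) (use fS(1) in blast)
      ultimately show "z \<in> generate (ob W \<Omega>) (?gen A)" by blast
    qed
    finally show ?thesis .
  qed
qed

end

section \<open>The filtration of a submodule and descent of membership along injections\<close>

context sub_FI_module
begin

lemma FI_img_FI_sub: "FI_img (FI_sub W V) \<Omega> A = ind W A \<Omega> (\<lambda>i\<in>A. i) ` V A"
  by (simp add: FI_img_def FI_sub_def)

lemma FI_sub_carrier: "\<lbrakk>finite A; x \<in> V A\<rbrakk> \<Longrightarrow> x \<in> carrier (ob W A)"
  using sub_subgroup subgroup.mem_carrier by fast

lemma FI_img_FI_sub_le: "finite A \<Longrightarrow> FI_img (FI_sub W V) \<Omega> A \<subseteq> FI_img W \<Omega> A"
  unfolding FI_img_FI_sub unfolding FI_img_def by (intro image_mono subsetI FI_sub_carrier)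

lemma symmetric_filtration_FI_img:
  assumes \<Omega>: "finite \<Omega>"
    and k: "generated_in_degree_le W k" and d: "generated_in_degree_le (FI_sub W V) d"
  shows "symmetric_filtration (ob W \<Omega>) \<Omega> (\<lambda>\<sigma>. ind W \<Omega> \<Omega> (restrict \<sigma> \<Omega>))
    (FI_img W \<Omega>) (FI_img (FI_sub W V) \<Omega>) k d"
proof -
  interpret O: comm_group "ob W \<Omega>" using ob_comm_group[OF \<Omega>] .
  interpret S: FI_module "FI_sub W V" by (rule FI_module_FI_sub)
  have fin: "finite B" if "B \<subseteq> \<Omega>" for B using that \<Omega> finite_subset by blast
  have perm: "restrict \<sigma> \<Omega> \<in> FI_hom \<Omega> \<Omega>" if "\<sigma> permutes \<Omega>" for \<sigma>
    using FI_hom_restrict[OF that order_refl] permutes_image[OF that] by simp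
  have V\<Omega>: "subgroup (V \<Omega>) (ob W \<Omega>)" by (rule sub_subgroup[OF \<Omega>])
  have sub: "FI_img (FI_sub W V) \<Omega> B \<subseteq> V \<Omega>" if "B \<subseteq> \<Omega>" for B
    using sub_ind[OF fin[OF that] \<Omega> FI_hom_inclusion[OF that]] by (auto simp: FI_img_FI_sub)
  show ?thesis
  proof (intro symmetric_filtration.intro symmetric_filtration_axioms.intro O.comm_group_axioms)
    fix \<sigma> \<tau> x assume "\<sigma> permutes \<Omega>" "\<tau> permutes \<Omega>" "x \<in> carrier (ob W \<Omega>)"
    moreover from this have "restrict (\<sigma> \<circ> \<tau>) \<Omega> = compose \<Omega> (restrict \<sigma> \<Omega>) (restrict \<tau> \<Omega>)"
      by (auto simp: compose_def fun_eq_iff permutes_in_image)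
    ultimately show "ind W \<Omega> \<Omega> (restrict (\<sigma> \<circ> \<tau>) \<Omega>) x
        = ind W \<Omega> \<Omega> (restrict \<sigma> \<Omega>) (ind W \<Omega> \<Omega> (restrict \<tau> \<Omega>) x)"
      using ind_compose[OF \<Omega> \<Omega> \<Omega> perm perm] by simp
  next
    fix \<sigma> B x assume *: "\<sigma> permutes \<Omega>" "B \<subseteq> \<Omega>" "\<And>b. b \<in> B \<Longrightarrow> \<sigma> b = b" "x \<in> FI_img W \<Omega> B"
    have "restrict \<sigma> B = (\<lambda>i\<in>B. i)" using *(3) by (auto simp: fun_eq_iff)
    then show "ind W \<Omega> \<Omega> (restrict \<sigma> \<Omega>) x = x"
      using * by (auto simp: FI_img_def ind_permutation_FI_img[OF \<Omega>])
  next
    fix \<sigma> B x assume *: "\<sigma> permutes \<Omega>" "B \<subseteq> \<Omega>" "x \<in> FI_img (FI_sub W V) \<Omega> B"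
    then obtain y where y: "y \<in> V B" "x = ind W B \<Omega> (\<lambda>i\<in>B. i) y" by (auto simp: FI_img_FI_sub)
    have im: "\<sigma> ` B \<subseteq> \<Omega>" using *(1,2) permutes_image by blast
    have r: "restrict \<sigma> B \<in> FI_hom B (\<sigma> ` B)" using * by (intro FI_hom_restrict)
    have "ind W \<Omega> \<Omega> (restrict \<sigma> \<Omega>) x = ind W B \<Omega> (restrict \<sigma> B) y"
      using * y fin FI_sub_carrier by (simp add: ind_permutation_FI_img[OF \<Omega>])
    also have "\<dots> = ind W (\<sigma> ` B) \<Omega> (\<lambda>i\<in>\<sigma> ` B. i) (ind W B (\<sigma> ` B) (restrict \<sigma> B) y)"
      using * y im fin r FI_sub_carrier \<Omega> by (simp add: ind_inclusion)
    finally show "ind W \<Omega> \<Omega> (restrict \<sigma> \<Omega>) x \<in> FI_img (FI_sub W V) \<Omega> (\<sigma> ` B)"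
      using sub_ind[OF fin[OF *(2)] fin[OF im] r y(1)] by (simp add: FI_img_FI_sub)
  next
    fix B assume B: "B \<subseteq> \<Omega>"
    interpret group_hom "ob W B" "ob W \<Omega>" "ind W B \<Omega> (\<lambda>i\<in>B. i)"
      using B \<Omega> fin by (intro ind_group_hom FI_hom_inclusion)
    show "subgroup (FI_img (FI_sub W V) \<Omega> B) (ob W \<Omega>)"
      unfolding FI_img_FI_sub using sub_subgroup[OF fin[OF B]] by (rule subgroup_img_is_subgroup)
    \<comment> \<open>Generation for the submodule takes place in the group on
      \<open>V \<Omega>\<close> and has to be moved to the ambient group.\<close>
    have "generate (ob (FI_sub W V) \<Omega>) (\<Union>{FI_img (FI_sub W V) \<Omega> U |U. U \<subseteq> B \<and> card U \<le> d})
      = generate (ob W \<Omega>) (\<Union>{FI_img (FI_sub W V) \<Omega> U |U. U \<subseteq> B \<and> card U \<le> d})"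
    proof -
      have "\<Union>{FI_img (FI_sub W V) \<Omega> U |U. U \<subseteq> B \<and> card U \<le> d} \<subseteq> V \<Omega>"
        using sub B by blast
      from O.generate_consistent[OF this V\<Omega>] show ?thesis by (simp add: FI_sub_def)
    qed
    then show "FI_img (FI_sub W V) \<Omega> B
        \<subseteq> generate (ob W \<Omega>) (\<Union>{FI_img (FI_sub W V) \<Omega> U |U. U \<subseteq> B \<and> card U \<le> d})"
      using S.FI_img_generated[OF d \<Omega> B] by simp
    show "FI_img W \<Omega> B \<subseteq> carrier (ob W \<Omega>)"
      using FI_img_subgroup[OF \<Omega> B] subgroup.subset by blast
  next
    have "carrier (ob W \<Omega>) = FI_img W \<Omega> \<Omega>" by (auto simp: FI_img_def ind_id[OF \<Omega>])
    then show "carrier (ob W \<Omega>) \<subseteq> generate (ob W \<Omega>) (\<Union>{FI_img W \<Omega> U |U. U \<subseteq> \<Omega> \<and> card U \<le> k})"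
      using FI_img_generated[OF k \<Omega> order_refl] by simp
  next
    fix \<sigma> assume "\<sigma> permutes \<Omega>"
    then show "ind W \<Omega> \<Omega> (restrict \<sigma> \<Omega>) \<in> hom (ob W \<Omega>) (ob W \<Omega>)"
      by (intro ind_hom \<Omega> perm)
  next
    fix B assume "B \<subseteq> \<Omega>"
    then show "FI_img (FI_sub W V) \<Omega> B \<subseteq> FI_img W \<Omega> B"
      by (intro FI_img_FI_sub_le fin)
  qed (rule \<Omega> FI_img_mono S.FI_img_mono | assumption)+
qed

lemma mem_of_ind_mem:
  assumes tf: "torsion_free W"
    and k: "generated_in_degree_le W k" and d: "generated_in_degree_le (FI_sub W V) d"
    and fin: "finite S" "finite T" and f: "f \<in> FI_hom S T" and card: "min k d + d \<le> card S"
    and x: "x \<in> carrier (ob W S)" "ind W S T f x \<in> V T"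
  shows "x \<in> V S"
proof -
  obtain N where N: "T \<subseteq> {..<N}" using fin(2) finite_nat_iff_bounded by blast
  \<comment> \<open>Twice the size, so that the shift by \<open>N\<close> supplies fresh partners
    for \<open>T\<close>.\<close>
  define \<Omega> where "\<Omega> = {..<2 * N}"
  have \<Omega>: "finite \<Omega>" by (simp add: \<Omega>_def)
  interpret symmetric_filtration "ob W \<Omega>" \<Omega> "\<lambda>\<sigma>. ind W \<Omega> \<Omega> (restrict \<sigma> \<Omega>)"
    "FI_img W \<Omega>" "FI_img (FI_sub W V) \<Omega>" k d
    by (rule symmetric_filtration_FI_img[OF \<Omega> k d])
  have T: "T \<subseteq> \<Omega>" "inj_on ((+) N) T" "(+) N ` T \<subseteq> \<Omega> - T" using N by (auto simp: \<Omega>_def)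
  have f\<Omega>: "f \<in> FI_hom S \<Omega>" using f T(1) by (rule FI_hom_weaken)
  have fS: "f ` S \<subseteq> T" "card (f ` S) = card S" using f by (auto simp: FI_hom_def card_image)
  let ?z = "ind W S \<Omega> f x"
  have "?z \<in> FI_img (FI_sub W V) \<Omega> T"
    using ind_inclusion[OF \<Omega> T(1) fin(1) f x(1)] x(2) by (force simp: FI_img_FI_sub)
  moreover have "?z \<in> FI_img W \<Omega> (f ` S)" by (rule ind_in_FI_img[OF \<Omega> fin(1) f\<Omega> x(1)])
  ultimately have "?z \<in> FI_img (FI_sub W V) \<Omega> (f ` S)"
    using M_inter_V[OF T fS(1)] fS(2) card by simp
  then obtain v where v: "v \<in> V (f ` S)" "?z = ind W (f ` S) \<Omega> (\<lambda>i\<in>f ` S. i) v"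
    by (auto simp: FI_img_FI_sub)
  let ?g = "\<lambda>i\<in>f ` S. inv_into S f i"
  have g: "?g \<in> FI_hom (f ` S) S" using f by (rule FI_hom_inv_into)
  have "compose (f ` S) f ?g = (\<lambda>i\<in>f ` S. i)"
    by (auto simp: compose_def fun_eq_iff f_inv_into_f)
  \<comment> \<open>Pulling \<open>v\<close> back along the inverse of \<open>f\<close> gives an
    element of \<open>V S\<close> with the same image as \<open>x\<close>; torsion-freeness
    identifies the two.\<close>
  then have "ind W S \<Omega> f (ind W (f ` S) S ?g v) = ?z"
    using ind_compose[OF _ fin(1) \<Omega> g f\<Omega>] v FI_sub_carrier fin(1) by simp
  moreover have gv: "ind W (f ` S) S ?g v \<in> V S"
    using sub_ind[OF _ fin(1) g v(1)] fin(1) by simp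
  moreover have "inj_on (ind W S \<Omega> f) (carrier (ob W S))"
    using tf fin(1) \<Omega> f\<Omega> by (auto simp: torsion_free_def)
  ultimately have "ind W (f ` S) S ?g v = x"
    using x(1) FI_sub_carrier[OF fin(1)] by (auto dest: inj_onD)
  then show ?thesis using gv by simp
qed

end

section \<open>Triviality of kernels in the quotient\<close>

theorem corollaryF:
  fixes k d :: nat and M :: "'a FI_functor" and V :: "nat set \<Rightarrow> 'a set"
  assumes "FI_module M"
    and "torsion_free M"
    and "generated_in_degree_le M k"
    and "sub_FI_module M V"
    and "generated_in_degree_le (FI_sub M V) d"
  shows "torsion_free_in_degrees_ge (FI_quot M V) (min k d + d)"
  unfolding torsion_free_in_degrees_ge_def
proof (intro allI impI)
  interpret sub_FI_module M V by fact
  interpret Q: FI_module "FI_quot M V" by (rule FI_module_FI_quot)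
  fix S T f assume A: "finite S \<and> finite T \<and> min k d + d \<le> card S \<and> f \<in> FI_hom S T"
  then have fin: "finite S" "finite T" and f: "f \<in> FI_hom S T" by auto
  interpret S: comm_group "ob M S" using ob_comm_group[OF fin(1)] .
  interpret T: comm_group "ob M T" using ob_comm_group[OF fin(2)] .
  interpret q: group_hom "ob (FI_quot M V) S" "ob (FI_quot M V) T" "ind (FI_quot M V) S T f"
    by (rule Q.ind_group_hom[OF fin f])
  show "inj_on (ind (FI_quot M V) S T f) (carrier (ob (FI_quot M V) S))"
    unfolding q.inj_on_one_iff
  proof (intro allI impI)
    fix C assume "C \<in> carrier (ob (FI_quot M V) S)"
      and one: "ind (FI_quot M V) S T f C = \<one>\<^bsub>ob (FI_quot M V) T\<^esub>"
    then obtain x where x: "x \<in> carrier (ob M S)" and C: "C = V S #>\<^bsub>ob M S\<^esub> x"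
      by (auto simp: carrier_FI_quot)
    have "V T #>\<^bsub>ob M T\<^esub> ind M S T f x = V T"
      using one FI_quot_ind[OF fin f x] C by (simp add: FI_quot_def FactGroup_def)
    then have "ind M S T f x \<in> V T"
      using T.rcos_self[OF ind_closed[OF fin f x] sub_subgroup[OF fin(2)]] by simp
    then have "x \<in> V S"
      using A x assms by (intro mem_of_ind_mem[of k d S T f]) auto
    then show "C = \<one>\<^bsub>ob (FI_quot M V) S\<^esub>"
      using C S.coset_join2[OF x sub_subgroup[OF fin(1)]] by (simp add: FI_quot_def FactGroup_def)
  qed
qed

end
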